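(* Let $0<q<1$, $m\in\mathbb{N}_0$ and $\alpha\ge 0$. Then, for every $n\in\mathbb{N}$ and $x\in[0,1]$, $$S_n^{q,\alpha}(e_{m+1};x)=S_n^{q,\alpha}(e_m;x)-(1-x)\left(\frac{[n-1]_q}{[n]_q}\right)^m S_{n-1}^{q,\frac{q\alpha}{1+\alpha}}\left(e_m;\frac{qx}{1+\alpha}\right).$$
   Context: For $i\in\mathbb{N}_0$, $[i]_q=1+q+\cdots+q^{i-1}$, $[0]_q=0$; $[i]_q!=[1]_q\cdots[i]_q$, $[0]_q!=1$; and for $0\le k\le n$, $\begin{bmatrix} n\\k\end{bmatrix}_q=\frac{[n]_q!}{[k]_q!\,[n-k]_q!}$. Empty products equal $1$ and $0^0=1$. Write $e_m(t)=t^m$. For $\alpha\ge0$, $n\in\mathbb{N}$, $f\in C[0,1]$ and $x\in[0,1]$, the $q$-Stancu operator is $$S_n^{q,\alpha}(f;x)=\sum_{k=0}^{n}f\left(\frac{[k]_q}{[n]_q}\right)p_{n,k}^{q,\alpha}(x),\qquad p_{n,k}^{q,\alpha}(x)=\begin{bmatrix} n\\k\end{bmatrix}_q\frac{\prod_{i=0}^{k-1}(x+\alpha[i]_q)\prod_{s=0}^{n-1-k}(1-q^sx+\alpha[s]_q)}{\prod_{i=0}^{n-1}(1+\alpha[i]_q)}.$$ For $n=0$ (needed only when the index $n-1$ equals $0$), the convention is $S_0^{q,\alpha}(f;x)=f(0)$. *)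

theory Defs
  imports Complex_Main
begin

definition q_int :: "real \<Rightarrow> nat \<Rightarrow> real" where
  "q_int q i = (\<Sum>j<i. q ^ j)"

definition q_fact :: "real \<Rightarrow> nat \<Rightarrow> real" where
  "q_fact q i = (\<Prod>j=1..i. q_int q j)"

(* Only meaningful for k \<le> n, because of the truncated subtraction. *)
definition q_binom :: "real \<Rightarrow> nat \<Rightarrow> nat \<Rightarrow> real" where
  "q_binom q n k = q_fact q n / (q_fact q k * q_fact q (n - k))"

(* Basis function p_{n,k}^{q,\<alpha>}(x), for k \<le> n.  The upper limits k - 1, n - 1 - k and n - 1
   of the products are written as strict bounds, so that the products are empty (equal to 1)
   when k = 0, k = n and n = 0 respectively. *)
definition stancu_basis :: "real \<Rightarrow> real \<Rightarrow> nat \<Rightarrow> nat \<Rightarrow> real \<Rightarrow> real" where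
  "stancu_basis q \<alpha> n k x =
     q_binom q n k *
     ((\<Prod>i<k. x + \<alpha> * q_int q i) * (\<Prod>s<n - k. 1 - q ^ s * x + \<alpha> * q_int q s)) /
     (\<Prod>i<n. 1 + \<alpha> * q_int q i)"

(* q-Stancu operator S_n^{q,\<alpha>}(f; x).  The function f represents an element of C[0,1]; for
   q > 0 the operator uses only its values at the nodes [k]_q / [n]_q in [0,1].
   The case n = 0 is a convention. *)
definition q_stancu :: "real \<Rightarrow> real \<Rightarrow> nat \<Rightarrow> (real \<Rightarrow> real) \<Rightarrow> real \<Rightarrow> real" where
  "q_stancu q \<alpha> n f x =
     (if n = 0 then f 0
      else (\<Sum>k=0..n. f (q_int q k / q_int q n) * stancu_basis q \<alpha> n k x))"

definition monomial :: "nat \<Rightarrow> real \<Rightarrow> real" where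
  "monomial m t = t ^ m"

end

theory Submission
  imports Defs
begin

text \<open>
  By linearity, the difference of the two terms of degree \<open>n\<close> is the operator applied to
  \<open>e\<^sub>m - e\<^sub>m\<^sub>+\<^sub>1\<close>, whose value at the node \<open>[k]/[n]\<close> is
  \<open>([k]/[n])\<^sup>m (1 - [k]/[n])\<close>. So the identity follows term by term once
  \<open>(1 - [k]/[n]) p\<^sub>n\<^sub>,\<^sub>k\<close> is recognised as \<open>(1 - x)\<close> times a basis
  function of degree \<open>n - 1\<close> with transformed parameters; this is the content of
  \<open>stancu_basis_degree_reduction\<close>. The factor \<open>1 - [k]/[n]\<close> turns the
  \<open>q\<close>-binomial of \<open>n\<close> into \<open>q\<^sup>k\<close> times that of \<open>n - 1\<close>.
  In the second numerator product the \<open>s = 0\<close> factor splits off as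
  \<open>1 - x\<close>. In that product and in the denominator, each later factor is
  \<open>1 + \<alpha>\<close> times the factor of preceding index for the parameters
  \<open>q\<alpha>/(1 + \<alpha>)\<close> and \<open>qx/(1 + \<alpha>)\<close>, because
  \<open>1 + \<alpha>[s + 1] = (1 + \<alpha>) + q\<alpha>[s]\<close>; in the first numerator product
  \<open>q\<close> times a factor is \<open>1 + \<alpha>\<close> times the new one of the same index, which
  uses up the \<open>q\<^sup>k\<close>. The term \<open>k = n\<close> vanishes,
  and the powers of \<open>1 + \<alpha>\<close> cancel.
\<close>

lemma q_int_0 [simp]: "q_int q 0 = 0"
  by (simp add: q_int_def)

lemma q_int_add: "q_int q (k + l) = q_int q k + q ^ k * q_int q l"
  by (induction l) (simp_all add: q_int_def power_add algebra_simps)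

lemma q_int_Suc: "q_int q (Suc i) = 1 + q * q_int q i"
  using q_int_add[of q 1 i] by (simp add: q_int_def)

lemma q_int_nonneg: "0 < q \<Longrightarrow> 0 \<le> q_int q i"
  by (simp add: q_int_def sum_nonneg)

lemma q_int_Suc_pos: "0 < q \<Longrightarrow> 0 < q_int q (Suc i)"
  by (simp add: q_int_Suc add_pos_nonneg q_int_nonneg)

lemma q_fact_0 [simp]: "q_fact q 0 = 1"
  by (simp add: q_fact_def)

lemma q_fact_Suc: "q_fact q (Suc i) = q_fact q i * q_int q (Suc i)"
  by (simp add: q_fact_def)

lemma q_fact_pos: "0 < q \<Longrightarrow> 0 < q_fact q i"
  by (induction i) (simp_all add: q_fact_Suc q_int_Suc_pos)

text \<open>
  The \<open>q\<close>-analogue of the absorption identity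
  \<open>(n + 1 - k) binom (n + 1) k = (n + 1) binom n k\<close>: the difference
  \<open>[n + 1] - [k]\<close> equals \<open>q\<^sup>k [n + 1 - k]\<close>, which cancels the top factor of
  \<open>[n + 1 - k]!\<close>.
\<close>

lemma q_binom_absorption:
  assumes "0 < q" "k \<le> n"
  shows "(1 - q_int q k / q_int q (Suc n)) * q_binom q (Suc n) k = q ^ k * q_binom q n k"
proof -
  obtain l where n: "n = k + l" using assms(2) le_Suc_ex by blast
  have nz: "q_int q (Suc n) \<noteq> 0" "q_int q (Suc l) \<noteq> 0" "q_fact q k \<noteq> 0" "q_fact q l \<noteq> 0"
    using q_int_Suc_pos[OF assms(1)] q_fact_pos[OF assms(1)] by (metis less_irrefl)+
  have "1 - q_int q k / q_int q (Suc n) = q ^ k * q_int q (Suc l) / q_int q (Suc n)"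
    using nz q_int_add[of q k "Suc l"] by (simp add: n field_simps)
  moreover have "Suc n - k = Suc l" "n - k = l" by (simp_all add: n)
  ultimately show ?thesis
    using nz by (simp add: q_binom_def q_fact_Suc)
qed

text \<open>
  The parameter \<open>q\<alpha>/(1 + \<alpha>)\<close> and the argument \<open>qx/(1 + \<alpha>)\<close> are chosen
  so that all factors are rescaled by the same constant \<open>1 + \<alpha>\<close>. The two
  numerator products contribute \<open>k\<close> and \<open>n - k\<close> of these constants, which
  balance the \<open>n\<close> constants of the denominator; the \<open>q\<^sup>k\<close> released by the
  \<open>q\<close>-binomial is absorbed by the \<open>k\<close> factors \<open>x + \<alpha>[i]\<close>.
\<close>

lemma stancu_basis_degree_reduction:
  assumes "0 < q" "0 \<le> \<alpha>" "k \<le> n"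
  shows "(1 - q_int q k / q_int q (Suc n)) * stancu_basis q \<alpha> (Suc n) k x =
         (1 - x) * stancu_basis q (q * \<alpha> / (1 + \<alpha>)) n k (q * x / (1 + \<alpha>))"
proof -
  define c where "c = 1 + \<alpha>"
  have c: "c \<noteq> 0" using assms(2) by (simp add: c_def)
  define A where "A = (\<Prod>i<k. x + \<alpha> * q_int q i)"
  define B where "B = (\<Prod>s<n - k. 1 - q ^ Suc s * x + \<alpha> * q_int q (Suc s))"
  define D where "D = (\<Prod>i<n. 1 + \<alpha> * q_int q (Suc i))"
  have A': "(\<Prod>i<k. q * x / c + q * \<alpha> / c * q_int q i) = (q / c) ^ k * A"
  proof -
    have "q * x / c + q * \<alpha> / c * q_int q i = q / c * (x + \<alpha> * q_int q i)" for i
      by (simp add: algebra_simps add_divide_distrib)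
    then show ?thesis by (simp only: A_def prod.distrib prod_constant card_lessThan)
  qed
  have B': "(\<Prod>s<n - k. 1 - q ^ s * (q * x / c) + q * \<alpha> / c * q_int q s) = B / c ^ (n - k)"
  proof -
    have "1 - q ^ s * (q * x / c) + q * \<alpha> / c * q_int q s =
        (1 - q ^ Suc s * x + \<alpha> * q_int q (Suc s)) / c" for s
      using c by (simp add: q_int_Suc field_simps) (simp add: c_def algebra_simps)
    then show ?thesis by (simp add: B_def prod_dividef)
  qed
  have D': "(\<Prod>i<n. 1 + q * \<alpha> / c * q_int q i) = D / c ^ n"
  proof -
    have "1 + q * \<alpha> / c * q_int q i = (1 + \<alpha> * q_int q (Suc i)) / c" for i
      using c by (simp add: q_int_Suc field_simps) (simp add: c_def algebra_simps)
    then show ?thesis by (simp add: D_def prod_dividef)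
  qed
  have cn: "c ^ n = c ^ k * c ^ (n - k)"
    using assms(3) by (simp flip: power_add)
  have "stancu_basis q \<alpha> (Suc n) k x = q_binom q (Suc n) k * (A * ((1 - x) * B)) / D"
    unfolding stancu_basis_def A_def B_def D_def Suc_diff_le[OF assms(3)] prod.lessThan_Suc_shift
    by simp
  then have "(1 - q_int q k / q_int q (Suc n)) * stancu_basis q \<alpha> (Suc n) k x =
      ((1 - q_int q k / q_int q (Suc n)) * q_binom q (Suc n) k) * (A * ((1 - x) * B)) / D"
    by simp
  also have "\<dots> = (1 - x) * (q ^ k * q_binom q n k * (A * B) / D)"
    unfolding q_binom_absorption[OF assms(1,3)] by simp
  also have "q ^ k * q_binom q n k * (A * B) / D =
      stancu_basis q (q * \<alpha> / c) n k (q * x / c)"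
    unfolding stancu_basis_def A' B' D' cn using c by (simp add: power_divide)
  finally show ?thesis unfolding c_def .
qed

text \<open>
  The convention for degree \<open>0\<close> agrees with the general formula, since the only node is
  \<open>0 / 0 = 0\<close> and its basis function is \<open>1\<close>. This makes the recurrence uniform
  down to \<open>n = 1\<close>.
\<close>

lemma q_stancu_eq_sum:
  "q_stancu q \<alpha> n f x = (\<Sum>k\<le>n. f (q_int q k / q_int q n) * stancu_basis q \<alpha> n k x)"
  by (simp add: q_stancu_def stancu_basis_def q_binom_def atLeast0AtMost)

theorem theorem2p5:
  fixes q \<alpha> x :: real and m n :: nat
  assumes "0 < q" and "q < 1"
    and "\<alpha> \<ge> 0"
    and "n \<ge> 1"
    and "x \<in> {0..1}"
  shows "q_stancu q \<alpha> n (monomial (m + 1)) x =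
         q_stancu q \<alpha> n (monomial m) x
         - (1 - x) * (q_int q (n - 1) / q_int q n) ^ m
           * q_stancu q (q * \<alpha> / (1 + \<alpha>)) (n - 1) (monomial m) (q * x / (1 + \<alpha>))"
proof -
  obtain N where n: "n = Suc N" using assms(4) by (cases n) auto
  define t where "t k = q_int q k / q_int q n" for k
  define p' where "p' k = stancu_basis q (q * \<alpha> / (1 + \<alpha>)) N k (q * x / (1 + \<alpha>))" for k
  have "t n = 1" using q_int_Suc_pos[OF assms(1), of N] by (simp add: t_def n)
  \<comment> \<open>For \<open>N = 0\<close> the cancelled factor \<open>[N]\<close> is \<open>0\<close>, but then \<open>k = 0\<close> and both sides
      are \<open>0\<close>.\<close>
  have node: "t N * (q_int q k / q_int q N) = t k" if "k \<le> N" for k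
    using that q_int_Suc_pos[OF assms(1)] by (cases N) (auto simp: t_def less_imp_neq[symmetric])
  have "q_stancu q \<alpha> n (monomial m) x - q_stancu q \<alpha> n (monomial (m + 1)) x =
      (\<Sum>k\<le>Suc N. t k ^ m * ((1 - t k) * stancu_basis q \<alpha> n k x))"
    by (simp add: q_stancu_eq_sum monomial_def t_def n algebra_simps flip: sum_subtractf)
  also have "\<dots> = (\<Sum>k\<le>N. t k ^ m * ((1 - t k) * stancu_basis q \<alpha> n k x))"
    using \<open>t n = 1\<close> by (simp add: n)
  also have "\<dots> = (\<Sum>k\<le>N. t k ^ m * ((1 - x) * p' k))"
    using stancu_basis_degree_reduction[OF assms(1,3)]
    by (intro sum.cong) (simp_all add: t_def p'_def n)
  also have "\<dots> = (\<Sum>k\<le>N. (1 - x) * t N ^ m * ((q_int q k / q_int q N) ^ m * p' k))"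
  proof (intro sum.cong refl)
    fix k assume "k \<in> {..N}"
    then have "t k ^ m = t N ^ m * (q_int q k / q_int q N) ^ m"
      using node[of k] by (simp flip: power_mult_distrib)
    then show "t k ^ m * ((1 - x) * p' k) =
        (1 - x) * t N ^ m * ((q_int q k / q_int q N) ^ m * p' k)"
      by (simp only: mult_ac)
  qed
  also have "\<dots> = (1 - x) * t N ^ m *
      q_stancu q (q * \<alpha> / (1 + \<alpha>)) N (monomial m) (q * x / (1 + \<alpha>))"
    by (simp add: q_stancu_eq_sum monomial_def p'_def sum_distrib_left)
  finally show ?thesis by (simp add: t_def n)
qed

end
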